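(* Let $n, r\in \mathbb{N}$ with $n \geq 2r$. Then $$P_{n-2r,\, n}\left(\frac{n}{2}\right) = P_{2r-1}\left(n-1, \frac{n}{2}\right) = 0.$$
   Context: $\mathbb{N}=\{1,2,3,\ldots\}$. $(a)_n := a(a+1)\cdots(a+n-1)$ is the rising factorial, with $(a)_0=1$. Two families of polynomials appear, distinguished by notation. Generalized Stirling polynomials of the first kind $P_{k,n}(z)$, $0\le k\le n-1$, are defined by the polynomial identity in $x$ $$\prod_{k=1}^{n-1} (k+x-z) = \sum_{k=0}^{n-1} P_{k, n}(z)\, x^k .$$ Signed generalized Stirling polynomials of the first kind $P_k(m,x)$, $0\le k\le m$, are defined by the polynomial identity in $j$ $$(j+1)_m = \sum_{k=0}^m (-1)^k P_k(m, x)\,(j + x)^{m-k}.$$ *)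

theory Defs
  imports Complex_Main "HOL-Computational_Algebra.Polynomial"
begin

text \<open>
  Coefficients \<open>P_{k,n}(z)\<close> of \<open>(1 + x - z)...(n - 1 + x - z)\<close> as a polynomial in \<open>x\<close>, and
  coefficients \<open>P_k(m,x)\<close> of the expansion of the rising factorial \<open>(j+1)_m\<close>, a polynomial in \<open>j\<close>,
  in powers of \<open>j + x\<close>. The polynomial variable is \<open>[:0, 1:]\<close>; the other parameter is a scalar.
\<close>

definition gen_stirling :: "nat \<Rightarrow> nat \<Rightarrow> 'a::field_char_0 \<Rightarrow> 'a" where
  "gen_stirling k n z = coeff (\<Prod>i=1..n-1. [:of_nat i - z, 1:]) k"

definition is_signed_expansion :: "nat \<Rightarrow> 'a::field_char_0 \<Rightarrow> (nat \<Rightarrow> 'a) \<Rightarrow> bool" where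
  "is_signed_expansion m x c \<longleftrightarrow>
     pochhammer [:1, 1:] m = (\<Sum>k=0..m. smult ((-1) ^ k * c k) ([:x, 1:] ^ (m - k)))"

text \<open>The expansion only constrains the indices up to \<open>m\<close>; the values beyond are set to 0 to make the
  description definite (see \<open>ex1_signed_expansion\<close>).\<close>

definition signed_gen_stirling :: "nat \<Rightarrow> nat \<Rightarrow> 'a::field_char_0 \<Rightarrow> 'a" where
  "signed_gen_stirling k m x = (THE c. is_signed_expansion m x c \<and> (\<forall>i>m. c i = 0)) k"

lemma gen_stirling_identity:
  fixes z :: "'a::field_char_0"
  shows "(\<Prod>k=1..n-1. [:of_nat k - z, 1:]) = (\<Sum>k=0..n-1. smult (gen_stirling k n z) ([:0, 1:] ^ k))"
proof -
  let ?p = "\<Prod>k=1..n-1. [:of_nat k - z, 1:]"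
  have "degree ?p \<le> n - 1"
    using degree_prod_sum_le[of "{1..n-1}" "\<lambda>k. [:of_nat k - z, 1:]"] by simp
  hence "?p = (\<Sum>k\<le>n-1. monom (coeff ?p k) k)"
    by (rule poly_as_sum_of_monoms'[symmetric])
  thus ?thesis
    unfolding gen_stirling_def monom_altdef atMost_atLeast0 .
qed

lemma pcompose_power:
  fixes p q :: "'a::comm_semiring_1 poly"
  shows "pcompose (p ^ n) q = pcompose p q ^ n"
  by (induction n) (simp_all add: pcompose_mult pcompose_1)

lemma is_signed_expansion_iff:
  fixes x :: "'a::field_char_0"
  shows "is_signed_expansion m x c \<longleftrightarrow>
    (\<forall>k\<le>m. c k = (-1) ^ k * coeff (pcompose (pochhammer [:1, 1:] m) [:-x, 1:]) (m - k))"
proof -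
  let ?q = "pcompose (pochhammer [:1, 1:] m :: 'a poly) [:-x, 1:]"
  let ?S = "\<Sum>k=0..m. smult ((-1) ^ k * c k) ([:x, 1:] ^ (m - k))"
  let ?T = "\<Sum>k=0..m. monom ((-1) ^ k * c k) (m - k)"
  have inj: "a = b" if "pcompose a [:-x, 1:] = pcompose b [:-x, 1:]" for a b :: "'a poly"
  proof -
    have "pcompose (pcompose a [:-x, 1:]) [:x, 1:] = pcompose (pcompose b [:-x, 1:]) [:x, 1:]"
      using that by simp
    thus ?thesis by (simp flip: pcompose_assoc add: pcompose_pCons)
  qed
  have ST: "pcompose ?S [:-x, 1:] = ?T"
    by (simp add: pcompose_sum pcompose_smult pcompose_power pcompose_pCons monom_altdef)
  have iff: "is_signed_expansion m x c \<longleftrightarrow> ?q = ?T"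
  proof
    assume "is_signed_expansion m x c"
    thus "?q = ?T" unfolding is_signed_expansion_def ST[symmetric] by (rule arg_cong)
  next
    assume "?q = ?T"
    thus "is_signed_expansion m x c" unfolding is_signed_expansion_def ST[symmetric] by (rule inj)
  qed
  have deg: "degree ?q \<le> m"
  proof -
    have "degree (pochhammer [:1, 1:] m :: 'a poly) \<le> m"
      unfolding pochhammer_prod
      using degree_prod_sum_le[of "{0..<m}" "\<lambda>i. [:1, 1:] + of_nat i :: 'a poly"]
      by (simp add: of_nat_poly)
    thus ?thesis by (simp add: degree_pcompose)
  qed
  have coeffT: "coeff ?T i = (if i \<le> m then (-1) ^ (m - i) * c (m - i) else 0)" for i
  proof -
    have "coeff ?T i = (\<Sum>k=0..m. if k = m - i \<and> i \<le> m then (-1) ^ k * c k else 0)"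
      unfolding coeff_sum by (rule sum.cong) auto
    thus ?thesis by (cases "i \<le> m") simp_all
  qed
  have sgn: "(-1) ^ k * ((-1) ^ k * a) = a" for k and a :: 'a
    by (cases "even k") simp_all
  show ?thesis
  proof
    assume "is_signed_expansion m x c"
    hence "?q = ?T" using iff by simp
    hence "coeff ?q (m - k) = (-1) ^ k * c k" if "k \<le> m" for k
      using that coeffT[of "m - k"] by simp
    thus "\<forall>k\<le>m. c k = (-1) ^ k * coeff ?q (m - k)"
      by (simp add: sgn)
  next
    assume A: "\<forall>k\<le>m. c k = (-1) ^ k * coeff ?q (m - k)"
    have "coeff ?q i = coeff ?T i" for i
    proof (cases "i \<le> m")
      case True
      hence "c (m - i) = (-1) ^ (m - i) * coeff ?q i" using A by simp
      thus ?thesis using True coeffT[of i] by (simp add: sgn)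
    next
      case False
      thus ?thesis using deg coeffT[of i] by (simp add: coeff_eq_0)
    qed
    thus "is_signed_expansion m x c" using iff poly_eqI by blast
  qed
qed

lemma ex1_signed_expansion:
  fixes x :: "'a::field_char_0"
  shows "\<exists>!c. is_signed_expansion m x c \<and> (\<forall>i>m. c i = 0)"
proof (rule ex1I)
  show "is_signed_expansion m x (\<lambda>k. if k \<le> m then (-1) ^ k *
      coeff (pcompose (pochhammer [:1, 1:] m) [:-x, 1:]) (m - k) else 0) \<and>
    (\<forall>i>m. (if i \<le> m then (-1) ^ i *
      coeff (pcompose (pochhammer [:1, 1:] m) [:-x, 1:]) (m - i) else 0) = 0)"
    unfolding is_signed_expansion_iff by simp
next
  fix c assume "is_signed_expansion m x c \<and> (\<forall>i>m. c i = 0)"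
  thus "c = (\<lambda>k. if k \<le> m then (-1) ^ k *
      coeff (pcompose (pochhammer [:1, 1:] m) [:-x, 1:]) (m - k) else 0)"
    unfolding is_signed_expansion_iff by (auto simp: fun_eq_iff)
qed

lemma signed_gen_stirling_identity:
  fixes x :: "'a::field_char_0"
  shows "pochhammer [:1, 1:] m =
    (\<Sum>k=0..m. smult ((-1) ^ k * signed_gen_stirling k m x) ([:x, 1:] ^ (m - k)))"
  using theI'[OF ex1_signed_expansion[of m x]]
  unfolding signed_gen_stirling_def is_signed_expansion_def by blast

end

theory Submission
  imports Defs
begin

text \<open>
  Both numbers are, up to sign, the same coefficient of
  \<open>Q(x) = (1 + x - z)(2 + x - z)...(n - 1 + x - z)\<close>: substituting \<open>j = x - z\<close> turns the expansion of
  \<open>(j + 1)_(n-1)\<close> in powers of \<open>j + z\<close> into the expansion of \<open>Q\<close> in powers of \<open>x\<close>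
  (\<open>signed_gen_stirling_eq_gen_stirling\<close>). The replacement \<open>x \<mapsto> -x\<close>, \<open>z \<mapsto> n - z\<close> reverses the order of
  the factors of \<open>Q\<close> and changes the sign of each (\<open>gen_stirling_reflect\<close>). At the fixed point
  \<open>z = n/2\<close>, the polynomial \<open>Q\<close> is therefore even or odd, according to the parity of \<open>n - 1\<close>, and its
  coefficients at exponents of the other parity, such as \<open>n - 2r\<close>, vanish.
\<close>

lemma pcompose_pochhammer_shift:
  fixes x :: "'a::field_char_0"
  shows "pcompose (pochhammer [:1, 1:] m) [:-x, 1:] = (\<Prod>i=1..m. [:of_nat i - x, 1:])"
proof -
  have "pcompose (pochhammer [:1, 1:] m) [:-x, 1:] = (\<Prod>i=0..<m. [:of_nat (Suc i) - x, 1:])"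
    unfolding pochhammer_prod pcompose_prod
    by (intro prod.cong) (simp_all add: of_nat_poly pcompose_pCons)
  also have "\<dots> = (\<Prod>i=1..m. [:of_nat i - x, 1:])"
    using prod.shift_bounds_Suc_ivl[of "\<lambda>i. [:of_nat i - x, 1:]" 0 m]
    by (simp add: atLeastLessThanSuc_atLeastAtMost)
  finally show ?thesis .
qed

lemma signed_gen_stirling_eq_gen_stirling:
  fixes x :: "'a::field_char_0"
  assumes "k \<le> m"
  shows "signed_gen_stirling k m x = (-1) ^ k * gen_stirling (m - k) (Suc m) x"
proof -
  have "is_signed_expansion m x (\<lambda>k. signed_gen_stirling k m x)"
    unfolding is_signed_expansion_def by (rule signed_gen_stirling_identity)
  then show ?thesis
    using assms by (simp add: is_signed_expansion_iff pcompose_pochhammer_shift gen_stirling_def)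
qed

text \<open>
  The factor \<open>i - x - z\<close> equals \<open>-((n - i) + x - (n - z))\<close>, and \<open>i \<mapsto> n - i\<close> permutes the indices
  \<open>1, ..., n - 1\<close>.
\<close>

lemma gen_stirling_reflect:
  fixes z :: "'a::field_char_0"
  shows "gen_stirling k n (of_nat n - z) = (-1) ^ (n - 1 + k) * gen_stirling k n z"
proof -
  let ?Q = "\<lambda>z::'a. \<Prod>i=1..n-1. [:of_nat i - z, 1:]"
  have "pcompose (?Q z) [:0, -1:] = (\<Prod>i=1..n-1. - [:of_nat (n - i) - (of_nat n - z), 1:])"
    unfolding pcompose_prod
    by (intro prod.cong) (auto simp: pcompose_pCons of_nat_diff)
  also have "\<dots> = (\<Prod>i=1..n-1. - [:of_nat i - (of_nat n - z), 1:])"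
    by (rule prod.reindex_bij_witness[of _ "\<lambda>i. n - i" "\<lambda>i. n - i"]) auto
  also have "\<dots> = (-1) ^ (n - 1) * ?Q (of_nat n - z)"
    unfolding prod_uminus by simp
  finally have "coeff (pcompose (?Q z) [:0, -1:]) k =
      coeff ((-1) ^ (n - 1) * ?Q (of_nat n - z)) k"
    by simp
  then have "(-1) ^ k * gen_stirling k n z = (-1) ^ (n - 1) * gen_stirling k n (of_nat n - z)"
    unfolding coeff_pcompose_linear gen_stirling_def
    by (cases "even (n - 1)") simp_all
  then have "(-1) ^ (n - 1) * ((-1) ^ k * gen_stirling k n z) =
      (-1) ^ (n - 1) * ((-1) ^ (n - 1) * gen_stirling k n (of_nat n - z))"
    by simp
  then show ?thesis
    by (simp add: power_add mult.assoc flip: mult.assoc[of "(-1) ^ (n - 1)" "(-1) ^ (n - 1)"]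
        power_mult_distrib)
qed

lemma gen_stirling_half_eq_0:
  assumes "odd (n - 1 + k)"
  shows "gen_stirling k n (of_nat n / 2 :: 'a::field_char_0) = 0"
proof -
  have "gen_stirling k n (of_nat n / 2 :: 'a) = - gen_stirling k n (of_nat n / 2)"
    using gen_stirling_reflect[of k n "of_nat n / 2 :: 'a"] assms by simp
  then show ?thesis by simp
qed

theorem lemma2:
  fixes n r :: nat
  assumes "n \<ge> 1" and "r \<ge> 1" and "n \<ge> 2 * r"
  shows "gen_stirling (n - 2 * r) n (of_nat n / 2 :: 'a::field_char_0)
           = signed_gen_stirling (2 * r - 1) (n - 1) (of_nat n / 2)
       \<and> signed_gen_stirling (2 * r - 1) (n - 1) (of_nat n / 2 :: 'a) = 0"
proof -
  have "n - 1 + (n - 2 * r) = 2 * (n - r) - 1"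
    using assms by simp
  then have "odd (n - 1 + (n - 2 * r))"
    using assms by simp
  then have gen: "gen_stirling (n - 2 * r) n (of_nat n / 2 :: 'a) = 0"
    by (rule gen_stirling_half_eq_0)
  have "n - 1 - (2 * r - 1) = n - 2 * r" "Suc (n - 1) = n" "2 * r - 1 \<le> n - 1"
    using assms by simp_all
  then have "signed_gen_stirling (2 * r - 1) (n - 1) (of_nat n / 2 :: 'a) =
      (-1) ^ (2 * r - 1) * gen_stirling (n - 2 * r) n (of_nat n / 2)"
    by (simp add: signed_gen_stirling_eq_gen_stirling)
  with gen show ?thesis by simp
qed

end
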